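(* Let $p\ge3$ be a prime, $q\ge1$ an integer, $\theta=p^N$ with $N<0$ (so $|\theta|_p>1$), such that the roots $x_1,x_2$ of $x^2+(2\theta-\theta^2+2q-1)x+q^2=0$ lie in $\mathbb{Q}_p$, labelled so that $|x_1|_p=|\theta|_p^2$ and $|x_2|_p=|q/\theta|_p^2$. Let $V$ be the vertex set of the semi-infinite Cayley tree $\Gamma^2_+$ of order two with root $(0)$, and assume that $\{h_x\}_{x\in V\setminus\{(0)\}}$, $h_x\in\mathbb{Q}_p$, is a solution of $$h_x=g(h_{(x,1)})\,g(h_{(x,2)})\quad\text{for all }x\in V\setminus\{(0)\},\qquad g(t)=\frac{\theta t+q}{t+\theta+q-1}.$$ Then: (i) if $|h_x|_p<1$ for all $x\in V\setminus\{(0)\}$, then $h_x=x_2$ for every $x$; (ii) if $|h_x|_p>1$ for all $x\in V\setminus\{(0)\}$, then $h_x=x_1$ for every $x$.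
   Context: $\Gamma^2_+$ is the infinite rooted tree in which every vertex $x$ has exactly two direct successors, denoted $(x,1)$ and $(x,2)$. $|\cdot|_p$ is the $p$-adic absolute value. Being a solution includes that all the values $g(h_{x})$ involved are defined (no $h_x$ equals $1-\theta-q$). The displayed recursion is the restriction of the compatibility equation for $p$-adic quasi Gibbs measures of the $(q+1)$-state Potts model to the invariant line of boundary vectors $(\hat h_1,\dots,\hat h_q)=(1,\dots,1,h,1,\dots,1)$. *)

theory Defs
  imports Complex_Main "Berlekamp_Zassenhaus.Finite_Field"
begin

text \<open>
  The \<open>p\<close>-adic valuation and absolute value on the rationals. \<open>rat_padic_val\<close> is read off from
  the reduced fraction and is only meaningful for nonzero arguments.
\<close>

definition rat_padic_val :: "nat \<Rightarrow> rat \<Rightarrow> int" where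
  "rat_padic_val p r = int (multiplicity (int p) (fst (quotient_of r)))
               - int (multiplicity (int p) (snd (quotient_of r)))"

definition rat_padic_abs :: "nat \<Rightarrow> rat \<Rightarrow> real" where
  "rat_padic_abs p r = (if r = 0 then 0 else real p powi (- rat_padic_val p r))"

lemma rat_padic_val_Fract:
  assumes p: "prime p" and ab: "a \<noteq> 0" "b \<noteq> 0"
  shows "rat_padic_val p (Rat.Fract a b) = int (multiplicity (int p) a) - int (multiplicity (int p) b)"
proof -
  obtain c d where cd: "quotient_of (Rat.Fract a b) = (c, d)" by (cases "quotient_of (Rat.Fract a b)")
  have d: "d > 0" using quotient_of_denom_pos[OF cd] .
  have eq: "Rat.Fract a b = Rat.Fract c d"
    using quotient_of_div[OF cd] by (simp add: Fract_of_int_quotient)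
  hence cross: "a * d = c * b" using ab d by (simp add: eq_rat)
  have c: "c \<noteq> 0" using cross ab d by auto
  have P: "prime_elem (int p)" using p by (simp add: prime_imp_prime_elem)
  have "multiplicity (int p) a + multiplicity (int p) d = multiplicity (int p) c + multiplicity (int p) b"
    using arg_cong[OF cross, of "multiplicity (int p)"] ab c d P
    by (simp add: prime_elem_multiplicity_mult_distrib)
  thus ?thesis by (simp add: rat_padic_val_def cd)
qed

lemma rat_padic_abs_0 [simp]: "rat_padic_abs p 0 = 0" by (simp add: rat_padic_abs_def)

lemma rat_padic_abs_nonneg [simp]: "rat_padic_abs p r \<ge> 0" by (simp add: rat_padic_abs_def)

lemma rat_padic_abs_eq_0 [simp]: "prime p \<Longrightarrow> rat_padic_abs p r = 0 \<longleftrightarrow> r = 0"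
  by (auto simp: rat_padic_abs_def power_int_eq_0_iff dest: prime_gt_0_nat)

lemma rat_padic_abs_mult:
  assumes p: "prime p"
  shows "rat_padic_abs p (r * s) = rat_padic_abs p r * rat_padic_abs p s"
proof (cases "r = 0 \<or> s = 0")
  case False
  obtain a b where r: "r = Rat.Fract a b" "b > 0" by (cases r) auto
  obtain c d where s: "s = Rat.Fract c d" "d > 0" by (cases s) auto
  have nz: "a \<noteq> 0" "c \<noteq> 0" using False r s by (auto simp: rat_number_collapse)
  have P: "prime_elem (int p)" using p by (simp add: prime_imp_prime_elem)
  have v: "rat_padic_val p (r * s) = rat_padic_val p r + rat_padic_val p s"
    using nz r s p P by (simp add: rat_padic_val_Fract prime_elem_multiplicity_mult_distrib)
  have "real p \<noteq> 0" using p by (simp add: prime_gt_0_nat)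
  thus ?thesis using False by (simp add: rat_padic_abs_def v power_int_diff power_int_minus power_int_add divide_inverse)
qed auto

lemma rat_padic_abs_1 [simp]: "prime p \<Longrightarrow> rat_padic_abs p 1 = 1"
  using rat_padic_abs_mult[of p 1 1] rat_padic_abs_eq_0[of p 1] by simp

lemma rat_padic_abs_minus [simp]:
  assumes p: "prime p" shows "rat_padic_abs p (- r) = rat_padic_abs p r"
proof -
  have "rat_padic_abs p (-1) * rat_padic_abs p (-1) = 1" using rat_padic_abs_mult[OF p, of "-1" "-1"] p by simp
  hence "rat_padic_abs p (-1) = 1" using rat_padic_abs_nonneg[of p "-1"]
    by (metis abs_of_nonneg abs_1 abs_mult_self_eq power2_eq_square real_sqrt_abs real_sqrt_one)
  thus ?thesis using rat_padic_abs_mult[OF p, of "-1" r] by simp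
qed

lemma rat_padic_abs_minus_commute: "prime p \<Longrightarrow> rat_padic_abs p (r - s) = rat_padic_abs p (s - r)"
  using rat_padic_abs_minus[of p "r - s"] by simp

lemma rat_padic_abs_inverse:
  assumes p: "prime p" shows "rat_padic_abs p (inverse r) = inverse (rat_padic_abs p r)"
proof (cases "r = 0")
  case False
  hence "rat_padic_abs p r * rat_padic_abs p (inverse r) = 1"
    using rat_padic_abs_mult[OF p, of r "inverse r"] p by simp
  thus ?thesis by (metis inverse_unique)
qed simp

lemma rat_padic_abs_add:
  assumes p: "prime p"
  shows "rat_padic_abs p (r + s) \<le> max (rat_padic_abs p r) (rat_padic_abs p s)"
proof (cases "r = 0 \<or> s = 0 \<or> r + s = 0")
  case False
  obtain a b where r: "r = Rat.Fract a b" "b > 0" by (cases r) auto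
  obtain c d where s: "s = Rat.Fract c d" "d > 0" by (cases s) auto
  have nz: "a \<noteq> 0" "c \<noteq> 0" using False r s by (auto simp: rat_number_collapse)
  have rs: "r + s = Rat.Fract (a * d + c * b) (b * d)" using r s by simp
  have nz2: "a * d + c * b \<noteq> 0" using False rs by (auto simp: rat_number_collapse)
  have P: "prime_elem (int p)" using p by (simp add: prime_imp_prime_elem)
  let ?v = "multiplicity (int p)"
  have "int p ^ min (?v (a*d)) (?v (c*b)) dvd a * d + c * b"
    by (intro dvd_add multiplicity_dvd') auto
  hence le: "min (?v (a*d)) (?v (c*b)) \<le> ?v (a * d + c * b)"
    using nz2 P by (intro multiplicity_geI) auto
  have "min (rat_padic_val p r) (rat_padic_val p s) \<le> rat_padic_val p (r + s)"
    unfolding rs using le nz nz2 r s p P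
    by (simp add: rat_padic_val_Fract prime_elem_multiplicity_mult_distrib min_def split: if_splits)
  moreover have "real p \<ge> 1" using prime_gt_0_nat[OF p] by simp
  ultimately have "real p powi (- rat_padic_val p (r + s)) \<le> max (real p powi (- rat_padic_val p r)) (real p powi (- rat_padic_val p s))"
    by (auto simp: le_max_iff_disj min_le_iff_disj intro!: power_int_increasing)
  thus ?thesis using False by (simp add: rat_padic_abs_def)
qed (auto simp: le_max_iff_disj)

lemma rat_padic_abs_add_le: "prime p \<Longrightarrow> rat_padic_abs p (r + s) \<le> rat_padic_abs p r + rat_padic_abs p s"
  using rat_padic_abs_add[of p r s] rat_padic_abs_nonneg[of p r] rat_padic_abs_nonneg[of p s] by linarith

definition padic_cauchy :: "nat \<Rightarrow> (nat \<Rightarrow> rat) \<Rightarrow> bool" where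
  "padic_cauchy p X \<longleftrightarrow> (\<forall>e>0. \<exists>k. \<forall>m\<ge>k. \<forall>n\<ge>k. rat_padic_abs p (X m - X n) < e)"

definition padic_null :: "nat \<Rightarrow> (nat \<Rightarrow> rat) \<Rightarrow> bool" where
  "padic_null p X \<longleftrightarrow> (\<lambda>n. rat_padic_abs p (X n)) \<longlonglongrightarrow> 0"


lemma padic_null_add:
  assumes "prime p" "padic_null p X" "padic_null p Y"
  shows "padic_null p (\<lambda>n. X n + Y n)"
proof -
  have "(\<lambda>n. rat_padic_abs p (X n) + rat_padic_abs p (Y n)) \<longlonglongrightarrow> 0"
    using assms(2,3) tendsto_add unfolding padic_null_def by fastforce
  thus ?thesis unfolding padic_null_def
    by (rule tendsto_sandwich[OF _ _ tendsto_const, rotated 2])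
      (auto intro!: always_eventually rat_padic_abs_add_le assms)
qed

lemma padic_null_minus: "prime p \<Longrightarrow> padic_null p (\<lambda>n. - X n) = padic_null p X"
  by (simp add: padic_null_def)

lemma padic_null_0 [simp]: "padic_null p (\<lambda>n. 0)"
  by (simp add: padic_null_def)

lemma padic_cauchy_const [simp]: "padic_cauchy p (\<lambda>n. c)"
  by (simp add: padic_cauchy_def)

lemma padic_cauchyD:
  "padic_cauchy p X \<Longrightarrow> e > 0 \<Longrightarrow> \<exists>k. \<forall>m\<ge>k. \<forall>n\<ge>k. rat_padic_abs p (X m - X n) < e"
  by (simp add: padic_cauchy_def)

lemma padic_cauchy_add:
  assumes p: "prime p" and X: "padic_cauchy p X" and Y: "padic_cauchy p Y"
  shows "padic_cauchy p (\<lambda>n. X n + Y n)"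
  unfolding padic_cauchy_def
proof (intro allI impI)
  fix e :: real assume e: "e > 0"
  obtain k l where k: "\<forall>m\<ge>k. \<forall>n\<ge>k. rat_padic_abs p (X m - X n) < e"
    and l: "\<forall>m\<ge>l. \<forall>n\<ge>l. rat_padic_abs p (Y m - Y n) < e"
    using padic_cauchyD[OF X e] padic_cauchyD[OF Y e] by blast
  have "rat_padic_abs p (X m + Y m - (X n + Y n)) < e" if "m \<ge> max k l" "n \<ge> max k l" for m n
  proof -
    have "rat_padic_abs p (X m + Y m - (X n + Y n)) \<le> max (rat_padic_abs p (X m - X n)) (rat_padic_abs p (Y m - Y n))"
      using rat_padic_abs_add[OF p, of "X m - X n" "Y m - Y n"] by (simp add: algebra_simps)
    also have "\<dots> < e" using k l that by simp
    finally show ?thesis .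
  qed
  thus "\<exists>k. \<forall>m\<ge>k. \<forall>n\<ge>k. rat_padic_abs p (X m + Y m - (X n + Y n)) < e" by blast
qed

lemma padic_cauchy_minus:
  assumes "prime p" "padic_cauchy p X" shows "padic_cauchy p (\<lambda>n. - X n)"
  using assms rat_padic_abs_minus_commute[OF assms(1)] by (simp add: padic_cauchy_def)

lemma padic_cauchy_bounded:
  assumes p: "prime p" and X: "padic_cauchy p X"
  obtains B where "B > 0" "\<And>n. rat_padic_abs p (X n) \<le> B"
proof -
  obtain k where k: "\<forall>m\<ge>k. \<forall>n\<ge>k. rat_padic_abs p (X m - X n) < 1"
    using padic_cauchyD[OF X zero_less_one] by blast
  define M where "M = Max ((\<lambda>n. rat_padic_abs p (X n)) ` {..k})"
  have M: "rat_padic_abs p (X n) \<le> M" if "n \<le> k" for n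
    unfolding M_def using that by simp
  have "rat_padic_abs p (X n) \<le> max M 1" for n
  proof (cases "n \<le> k")
    case False
    have "rat_padic_abs p (X n) \<le> max (rat_padic_abs p (X k)) (rat_padic_abs p (X n - X k))"
      using rat_padic_abs_add[OF p, of "X k" "X n - X k"] by simp
    also have "\<dots> \<le> max M 1"
      using M[of k] k[rule_format, of n k] False by (intro max.mono) auto
    finally show ?thesis .
  qed (use M in \<open>auto simp: le_max_iff_disj\<close>)
  thus thesis by (intro that[of "max M 1"]) auto
qed

lemma padic_null_mult_bounded:
  assumes p: "prime p" and X: "padic_cauchy p X" and Y: "padic_null p Y"
  shows "padic_null p (\<lambda>n. X n * Y n)"
proof -
  obtain B where B: "\<And>n. rat_padic_abs p (X n) \<le> B" using padic_cauchy_bounded[OF p X] by metis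
  have "(\<lambda>n. B * rat_padic_abs p (Y n)) \<longlonglongrightarrow> 0"
    using Y unfolding padic_null_def by (rule tendsto_mult_right_zero)
  thus ?thesis unfolding padic_null_def
    by (rule tendsto_sandwich[OF _ _ tendsto_const, rotated 2])
      (auto intro!: always_eventually mult_right_mono B simp: rat_padic_abs_mult[OF p])
qed

lemma padic_cauchy_mult:
  assumes p: "prime p" and X: "padic_cauchy p X" and Y: "padic_cauchy p Y"
  shows "padic_cauchy p (\<lambda>n. X n * Y n)"
  unfolding padic_cauchy_def
proof (intro allI impI)
  fix e :: real assume e: "e > 0"
  obtain A where A: "A > 0" "\<And>n. rat_padic_abs p (X n) \<le> A" using padic_cauchy_bounded[OF p X] by metis
  obtain B where B: "B > 0" "\<And>n. rat_padic_abs p (Y n) \<le> B" using padic_cauchy_bounded[OF p Y] by metis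
  obtain k l where k: "\<forall>m\<ge>k. \<forall>n\<ge>k. rat_padic_abs p (X m - X n) < e / B"
    and l: "\<forall>m\<ge>l. \<forall>n\<ge>l. rat_padic_abs p (Y m - Y n) < e / A"
    using padic_cauchyD[OF X, of "e / B"] padic_cauchyD[OF Y, of "e / A"] e A B by auto
  have "rat_padic_abs p (X m * Y m - X n * Y n) < e" if mn: "m \<ge> max k l" "n \<ge> max k l" for m n
  proof -
    have "X m * Y m - X n * Y n = (X m - X n) * Y m + X n * (Y m - Y n)"
      by (simp add: algebra_simps)
    hence "rat_padic_abs p (X m * Y m - X n * Y n)
        \<le> max (rat_padic_abs p (X m - X n) * rat_padic_abs p (Y m)) (rat_padic_abs p (X n) * rat_padic_abs p (Y m - Y n))"
      using rat_padic_abs_add[OF p] by (metis rat_padic_abs_mult[OF p])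
    also have "\<dots> \<le> max (rat_padic_abs p (X m - X n) * B) (A * rat_padic_abs p (Y m - Y n))"
      using A B by (intro max.mono mult_left_mono mult_right_mono) auto
    also have "\<dots> < e"
      using k[rule_format, of m n] l[rule_format, of m n] mn A B by (simp add: field_simps)
    finally show ?thesis .
  qed
  thus "\<exists>k. \<forall>m\<ge>k. \<forall>n\<ge>k. rat_padic_abs p (X m * Y m - X n * Y n) < e" by blast
qed

lemma padic_cauchy_away:
  assumes p: "prime p" and X: "padic_cauchy p X" and nz: "\<not> padic_null p X"
  obtains b k where "b > 0" "\<And>n. n \<ge> k \<Longrightarrow> rat_padic_abs p (X n) \<ge> b"
proof -
  obtain b where b: "b > 0" "\<forall>k. \<exists>n\<ge>k. \<not> rat_padic_abs p (X n) < b"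
    using nz unfolding padic_null_def lim_sequentially dist_real_def by auto
  obtain k where k: "\<forall>m\<ge>k. \<forall>n\<ge>k. rat_padic_abs p (X m - X n) < b"
    using padic_cauchyD[OF X b(1)] by blast
  obtain j where j: "j \<ge> k" "rat_padic_abs p (X j) \<ge> b" using b(2) not_less by blast
  have "rat_padic_abs p (X n) \<ge> b" if "n \<ge> k" for n
  proof (rule ccontr)
    assume "\<not> rat_padic_abs p (X n) \<ge> b"
    moreover have "rat_padic_abs p (X j) \<le> max (rat_padic_abs p (X n)) (rat_padic_abs p (X j - X n))"
      using rat_padic_abs_add[OF p, of "X n" "X j - X n"] by simp
    moreover have "rat_padic_abs p (X j - X n) < b" using k j that by blast
    ultimately show False using j(2) by linarith
  qed
  thus thesis using that b(1) by blast
qed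

lemma padic_cauchy_inverse:
  assumes p: "prime p" and X: "padic_cauchy p X" and nz: "\<not> padic_null p X"
  shows "padic_cauchy p (\<lambda>n. inverse (X n))"
  unfolding padic_cauchy_def
proof (intro allI impI)
  fix e :: real assume e: "e > 0"
  obtain b k where b: "b > 0" and k: "\<And>n. n \<ge> k \<Longrightarrow> rat_padic_abs p (X n) \<ge> b"
    using padic_cauchy_away[OF p X nz] by metis
  obtain l where l: "\<forall>m\<ge>l. \<forall>n\<ge>l. rat_padic_abs p (X m - X n) < e * (b * b)"
    using padic_cauchyD[OF X, of "e * (b * b)"] e b by auto
  have "rat_padic_abs p (inverse (X m) - inverse (X n)) < e" if mn: "m \<ge> max k l" "n \<ge> max k l" for m n
  proof -
    have bm: "rat_padic_abs p (X m) \<ge> b" "rat_padic_abs p (X n) \<ge> b" using k mn by auto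
    hence nz': "X m \<noteq> 0" "X n \<noteq> 0" using b by auto
    have "inverse (X m) - inverse (X n) = (X n - X m) * inverse (X m * X n)"
      using nz' by (simp add: field_simps)
    hence "rat_padic_abs p (inverse (X m) - inverse (X n))
        = rat_padic_abs p (X n - X m) / (rat_padic_abs p (X m) * rat_padic_abs p (X n))"
      by (simp only: rat_padic_abs_mult[OF p] rat_padic_abs_inverse[OF p] divide_inverse)
    also have "\<dots> \<le> rat_padic_abs p (X n - X m) / (b * b)"
      using b bm by (intro divide_left_mono mult_mono mult_pos_pos) auto
    also have "\<dots> < e" using l[rule_format, of n m] mn b by (simp add: field_simps)
    finally show ?thesis .
  qed
  thus "\<exists>k. \<forall>m\<ge>k. \<forall>n\<ge>k. rat_padic_abs p (inverse (X m) - inverse (X n)) < e" by blast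
qed

lemma padic_null_inverse_mult:
  assumes p: "prime p" and X: "padic_cauchy p X" and nz: "\<not> padic_null p X"
  shows "padic_null p (\<lambda>n. inverse (X n) * X n - 1)"
proof -
  obtain b k where b: "b > 0" and k: "\<And>n. n \<ge> k \<Longrightarrow> rat_padic_abs p (X n) \<ge> b"
    using padic_cauchy_away[OF p X nz] by metis
  have "eventually (\<lambda>n. rat_padic_abs p (inverse (X n) * X n - 1) = 0) sequentially"
    unfolding eventually_sequentially
  proof (intro exI allI impI)
    fix n assume "n \<ge> k"
    hence "X n \<noteq> 0" using k[of n] b by auto
    thus "rat_padic_abs p (inverse (X n) * X n - 1) = 0" by simp
  qed
  thus ?thesis unfolding padic_null_def by (rule tendsto_eventually)
qed

lemma rat_padic_abs_diff_abs:
  assumes p: "prime p"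
  shows "\<bar>rat_padic_abs p r - rat_padic_abs p s\<bar> \<le> rat_padic_abs p (r - s)"
  using rat_padic_abs_add_le[OF p, of "r - s" s] rat_padic_abs_add_le[OF p, of "s - r" r]
    rat_padic_abs_minus_commute[OF p, of r s] by simp

lemma padic_cauchy_convergent_abs:
  assumes p: "prime p" and X: "padic_cauchy p X"
  shows "convergent (\<lambda>n. rat_padic_abs p (X n))"
proof (rule Cauchy_convergent, rule metric_CauchyI)
  fix e :: real assume "e > 0"
  then obtain k where "\<forall>m\<ge>k. \<forall>n\<ge>k. rat_padic_abs p (X m - X n) < e" using padic_cauchyD[OF X] by blast
  thus "\<exists>k. \<forall>m\<ge>k. \<forall>n\<ge>k. dist (rat_padic_abs p (X m)) (rat_padic_abs p (X n)) < e"
    unfolding dist_real_def using rat_padic_abs_diff_abs[OF p] le_less_trans by blast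
qed

lemma padic_null_imp_same_lim:
  assumes p: "prime p" and N: "padic_null p (\<lambda>n. X n - Y n)"
  shows "lim (\<lambda>n. rat_padic_abs p (X n)) = lim (\<lambda>n. rat_padic_abs p (Y n))"
proof -
  have "(\<lambda>n. \<bar>rat_padic_abs p (X n) - rat_padic_abs p (Y n)\<bar>) \<longlonglongrightarrow> 0"
    by (rule tendsto_sandwich[OF _ _ tendsto_const N[unfolded padic_null_def]])
      (auto intro!: always_eventually rat_padic_abs_diff_abs p)
  hence D: "(\<lambda>n. rat_padic_abs p (X n) - rat_padic_abs p (Y n)) \<longlonglongrightarrow> 0"
    by (rule tendsto_rabs_zero_cancel)
  have "(\<lambda>n. rat_padic_abs p (X n)) \<longlonglongrightarrow> L \<longleftrightarrow> (\<lambda>n. rat_padic_abs p (Y n)) \<longlonglongrightarrow> L" for L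
    using tendsto_diff[OF _ D, of "\<lambda>n. rat_padic_abs p (X n)" L] tendsto_add[OF D, of "\<lambda>n. rat_padic_abs p (Y n)" L]
    by auto
  thus ?thesis by (simp add: lim_def)
qed

text \<open>
  The field of \<open>p\<close>-adic numbers is the completion of the rationals: Cauchy sequences for the
  \<open>p\<close>-adic absolute value modulo null sequences. The prime \<open>p = CARD('p)\<close> is carried by the type
  argument, so that \<open>'p padic\<close> can be an instance of class \<open>field\<close>.
\<close>

typedef (overloaded) 'p padic_seq = "{X. padic_cauchy CARD('p::prime_card) X}"
  by (rule exI[of _ "\<lambda>_. 0"]) simp

setup_lifting type_definition_padic_seq

lift_definition padic_seq_rel :: "'p::prime_card padic_seq \<Rightarrow> 'p padic_seq \<Rightarrow> bool"
  is "\<lambda>X Y. padic_null CARD('p) (\<lambda>n. X n - Y n)" .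

lemma equivp_padic_seq_rel: "equivp (padic_seq_rel :: 'p::prime_card padic_seq \<Rightarrow> _)"
proof (rule equivpI)
  have p: "prime CARD('p)" by (rule prime_card)
  show "reflp (padic_seq_rel :: 'p padic_seq \<Rightarrow> _)"
    by (rule reflpI, transfer) simp
  show "symp (padic_seq_rel :: 'p padic_seq \<Rightarrow> _)"
    by (rule sympI, transfer) (simp add: padic_null_def rat_padic_abs_minus_commute[OF p])
  show "transp (padic_seq_rel :: 'p padic_seq \<Rightarrow> _)"
    by (rule transpI, transfer) (auto dest: padic_null_add[OF p])
qed

quotient_type (overloaded) 'p padic = "'p::prime_card padic_seq" / padic_seq_rel
  by (rule equivp_padic_seq_rel)

lift_definition seq_zero :: "'p::prime_card padic_seq" is "\<lambda>_. 0" by simp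
lift_definition seq_one :: "'p::prime_card padic_seq" is "\<lambda>_. 1" by simp
lift_definition seq_plus :: "'p::prime_card padic_seq \<Rightarrow> 'p padic_seq \<Rightarrow> 'p padic_seq"
  is "\<lambda>X Y n. X n + Y n" by (rule padic_cauchy_add[OF prime_card])
lift_definition seq_uminus :: "'p::prime_card padic_seq \<Rightarrow> 'p padic_seq"
  is "\<lambda>X n. - X n" by (rule padic_cauchy_minus[OF prime_card])
lift_definition seq_times :: "'p::prime_card padic_seq \<Rightarrow> 'p padic_seq \<Rightarrow> 'p padic_seq"
  is "\<lambda>X Y n. X n * Y n" by (rule padic_cauchy_mult[OF prime_card])
lift_definition seq_inverse :: "'p::prime_card padic_seq \<Rightarrow> 'p padic_seq"
  is "\<lambda>X. if padic_null CARD('p) X then (\<lambda>_. 0) else (\<lambda>n. inverse (X n))"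
  by (auto intro: padic_cauchy_inverse[OF prime_card])
lift_definition seq_abs :: "'p::prime_card padic_seq \<Rightarrow> real"
  is "\<lambda>X. lim (\<lambda>n. rat_padic_abs CARD('p) (X n))" .

instantiation padic :: (prime_card) field
begin

lift_definition zero_padic :: "'a padic" is seq_zero .
lift_definition one_padic :: "'a padic" is seq_one .

lift_definition plus_padic :: "'a padic \<Rightarrow> 'a padic \<Rightarrow> 'a padic" is seq_plus
proof transfer
  fix X X' Y Y' :: "nat \<Rightarrow> rat"
  assume "padic_null CARD('a) (\<lambda>n. X n - X' n)" "padic_null CARD('a) (\<lambda>n. Y n - Y' n)"
  from padic_null_add[OF prime_card this]
  show "padic_null CARD('a) (\<lambda>n. X n + Y n - (X' n + Y' n))" by (simp add: algebra_simps)
qed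

lift_definition uminus_padic :: "'a padic \<Rightarrow> 'a padic" is seq_uminus
proof transfer
  fix X X' :: "nat \<Rightarrow> rat"
  assume "padic_null CARD('a) (\<lambda>n. X n - X' n)"
  thus "padic_null CARD('a) (\<lambda>n. - X n - - X' n)"
    by (simp add: padic_null_def rat_padic_abs_minus_commute[OF prime_card])
qed

lift_definition times_padic :: "'a padic \<Rightarrow> 'a padic \<Rightarrow> 'a padic" is seq_times
proof transfer
  fix X X' Y Y' :: "nat \<Rightarrow> rat"
  assume c: "padic_cauchy CARD('a) X" "padic_cauchy CARD('a) Y'"
    and n: "padic_null CARD('a) (\<lambda>n. X n - X' n)" "padic_null CARD('a) (\<lambda>n. Y n - Y' n)"
  from padic_null_add[OF prime_card padic_null_mult_bounded[OF prime_card c(2) n(1)]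
      padic_null_mult_bounded[OF prime_card c(1) n(2)]]
  show "padic_null CARD('a) (\<lambda>n. X n * Y n - X' n * Y' n)" by (simp add: algebra_simps)
qed

lift_definition inverse_padic :: "'a padic \<Rightarrow> 'a padic" is seq_inverse
proof transfer
  fix X Y :: "nat \<Rightarrow> rat"
  let ?p = "CARD('a)"
  assume c: "padic_cauchy ?p X" "padic_cauchy ?p Y" and n: "padic_null ?p (\<lambda>n. X n - Y n)"
  have p: "prime ?p" by (rule prime_card)
  have n': "padic_null ?p (\<lambda>n. Y n - X n)"
    using n by (simp add: padic_null_def rat_padic_abs_minus_commute[OF p])
  have iff: "padic_null ?p X \<longleftrightarrow> padic_null ?p Y"
    using padic_null_add[OF p n, of Y] padic_null_add[OF p n', of X] by auto
  show "padic_null ?p (\<lambda>n. (if padic_null ?p X then \<lambda>_. 0 else (\<lambda>n. inverse (X n))) n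
      - (if padic_null ?p Y then \<lambda>_. 0 else (\<lambda>n. inverse (Y n))) n)"
  proof (cases "padic_null ?p X")
    case False
    hence F: "\<not> padic_null ?p Y" using iff by simp
    have cX: "padic_cauchy ?p (\<lambda>n. inverse (X n))" using padic_cauchy_inverse[OF p c(1) False] .
    have cY: "padic_cauchy ?p (\<lambda>n. inverse (Y n))" using padic_cauchy_inverse[OF p c(2) F] .
    obtain b k where b: "b > 0" and k: "\<And>n. n \<ge> k \<Longrightarrow> rat_padic_abs ?p (X n) \<ge> b"
      using padic_cauchy_away[OF p c(1) False] by metis
    obtain d l where d: "d > 0" and l: "\<And>n. n \<ge> l \<Longrightarrow> rat_padic_abs ?p (Y n) \<ge> d"
      using padic_cauchy_away[OF p c(2) F] by metis
    have A: "padic_null ?p (\<lambda>n. inverse (X n) * inverse (Y n) * (Y n - X n))"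
      by (rule padic_null_mult_bounded[OF p padic_cauchy_mult[OF p cX cY] n'])
    have "eventually (\<lambda>n. rat_padic_abs ?p (inverse (X n) * inverse (Y n) * (Y n - X n))
        = rat_padic_abs ?p (inverse (X n) - inverse (Y n))) sequentially"
      unfolding eventually_sequentially
    proof (intro exI[of _ "max k l"] allI impI)
      fix n assume "n \<ge> max k l"
      hence "X n \<noteq> 0" "Y n \<noteq> 0" using k[of n] l[of n] b d by auto
      hence "inverse (X n) * inverse (Y n) * (Y n - X n) = inverse (X n) - inverse (Y n)"
        by (simp add: field_simps)
      thus "rat_padic_abs ?p (inverse (X n) * inverse (Y n) * (Y n - X n))
        = rat_padic_abs ?p (inverse (X n) - inverse (Y n))" by simp
    qed
    with A have "padic_null ?p (\<lambda>n. inverse (X n) - inverse (Y n))"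
      unfolding padic_null_def by (rule Lim_transform_eventually)
    thus ?thesis using False F by simp
  qed (simp add: iff)
qed

definition "x - y = x + - y" for x y :: "'a padic"
definition "x div y = x * inverse y" for x y :: "'a padic"

instance
proof
  fix a b c :: "'a padic"
  have p: "prime CARD('a)" by (rule prime_card)
  show "a + b = b + a" by (transfer, transfer) (simp add: add.commute)
  show "(a + b) + c = a + (b + c)" by (transfer, transfer) (simp add: add.assoc)
  show "0 + a = a" by (transfer, transfer) simp
  show "- a + a = 0" by (transfer, transfer) simp
  show "a - b = a + - b" by (rule minus_padic_def)
  show "(a * b) * c = a * (b * c)" by (transfer, transfer) (simp add: mult.assoc)
  show "a * b = b * a" by (transfer, transfer) (simp add: mult.commute)
  show "1 * a = a" by (transfer, transfer) simp
  show "(a + b) * c = a * c + b * c" by (transfer, transfer) (simp add: distrib_right)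
  show "(0::'a padic) \<noteq> 1"
    by (transfer, transfer) (simp add: padic_null_def LIMSEQ_const_iff p)
  show "a \<noteq> 0 \<Longrightarrow> inverse a * a = 1"
    by (transfer, transfer) (auto intro: padic_null_inverse_mult[OF p])
  show "a div b = a * inverse b" by (rule divide_padic_def)
  show "inverse (0::'a padic) = 0" by (transfer, transfer) simp
qed

end

lift_definition padic_abs :: "'p::prime_card padic \<Rightarrow> real" is seq_abs
  by transfer (rule padic_null_imp_same_lim[OF prime_card])

lemma padic_cauchy_abs_lim:
  "prime p \<Longrightarrow> padic_cauchy p X \<Longrightarrow>
    (\<lambda>n. rat_padic_abs p (X n)) \<longlonglongrightarrow> lim (\<lambda>n. rat_padic_abs p (X n))"
  using padic_cauchy_convergent_abs convergent_LIMSEQ_iff by blast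

lemma padic_abs_nonneg [simp]: "padic_abs x \<ge> 0"
  by (transfer, transfer)
    (rule LIMSEQ_le_const[OF padic_cauchy_abs_lim[OF prime_card]], auto)

lemma padic_abs_eq_0 [simp]:
  fixes x :: "'p::prime_card padic"
  shows "padic_abs x = 0 \<longleftrightarrow> x = 0"
proof (transfer, transfer)
  fix X assume X: "padic_cauchy CARD('p) X"
  show "lim (\<lambda>n. rat_padic_abs CARD('p) (X n)) = 0 \<longleftrightarrow> padic_null CARD('p) (\<lambda>n. X n - 0)"
    using padic_cauchy_abs_lim[OF prime_card X] by (auto simp: padic_null_def dest: limI)
qed

lemma padic_abs_mult:
  fixes x y :: "'p::prime_card padic"
  shows "padic_abs (x * y) = padic_abs x * padic_abs y"
  by (transfer, transfer)
    (auto intro!: limI tendsto_mult padic_cauchy_abs_lim simp: rat_padic_abs_mult prime_card)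

lemma padic_abs_add:
  fixes x y :: "'p::prime_card padic"
  shows "padic_abs (x + y) \<le> max (padic_abs x) (padic_abs y)"
proof (transfer, transfer)
  fix X Y assume X: "padic_cauchy CARD('p) X" and Y: "padic_cauchy CARD('p) Y"
  have p: "prime CARD('p)" by (rule prime_card)
  show "lim (\<lambda>n. rat_padic_abs CARD('p) (X n + Y n))
      \<le> max (lim (\<lambda>n. rat_padic_abs CARD('p) (X n))) (lim (\<lambda>n. rat_padic_abs CARD('p) (Y n)))"
    by (rule LIMSEQ_le[OF padic_cauchy_abs_lim[OF p padic_cauchy_add[OF p X Y]]
          tendsto_max[OF padic_cauchy_abs_lim[OF p X] padic_cauchy_abs_lim[OF p Y]]])
      (auto intro: rat_padic_abs_add[OF p])
qed

lift_definition seq_const :: "rat \<Rightarrow> 'p::prime_card padic_seq" is "\<lambda>r _. r" by simp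
lift_definition padic_const :: "rat \<Rightarrow> 'p::prime_card padic" is seq_const .

lemma padic_const_eq_iff: "(padic_const r :: 'p::prime_card padic) = padic_const s \<longleftrightarrow> r = s"
  by (transfer, transfer) (simp add: padic_null_def LIMSEQ_const_iff prime_card)

lemma padic_const_of_nat: "padic_const (of_nat n) = (of_nat n :: 'p::prime_card padic)"
proof (induction n)
  case 0
  show ?case by (simp, transfer, transfer) simp
next
  case (Suc n)
  have "padic_const (of_nat (Suc n)) = 1 + (padic_const (of_nat n) :: 'p padic)"
    by (transfer, transfer) simp
  thus ?case using Suc by simp
qed

instance padic :: (prime_card) field_char_0
proof
  show "inj (of_nat :: nat \<Rightarrow> 'a padic)"
    by (rule injI) (metis padic_const_of_nat padic_const_eq_iff of_nat_eq_iff)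
qed

lemma padic_const_eq_of_rat: "padic_const r = (of_rat r :: 'p::prime_card padic)"
proof -
  have m: "padic_const (a * b) = (padic_const a * padic_const b :: 'p padic)" for a b
    by (transfer, transfer) simp
  have n: "padic_const (- a) = (- padic_const a :: 'p padic)" for a
    by (transfer, transfer) simp
  have i: "padic_const (of_int k) = (of_int k :: 'p padic)" for k
    by (cases k rule: int_cases2)
      (metis of_int_of_nat_eq padic_const_of_nat, metis n of_int_minus of_int_of_nat_eq padic_const_of_nat)
  obtain a b where ab: "r = Rat.Fract a b" "b > 0" by (cases r) auto
  hence "r * of_int b = of_int a" by (simp add: Fract_of_int_quotient)
  hence "padic_const r * of_int b = (of_int a :: 'p padic)" using m i by metis
  moreover have "of_rat r * of_int b = (of_int a :: 'p padic)"
    using ab by (simp add: of_rat_rat)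
  moreover have "(of_int b :: 'p padic) \<noteq> 0" using ab by simp
  ultimately show ?thesis by (metis mult_right_cancel)
qed

lemma padic_abs_of_rat: "padic_abs (of_rat r :: 'p::prime_card padic) = rat_padic_abs CARD('p) r"
  unfolding padic_const_eq_of_rat[symmetric] by (transfer, transfer) simp

lemma padic_abs_prime: "padic_abs (of_nat CARD('p) :: 'p::prime_card padic) = inverse (real CARD('p))"
proof -
  have p: "prime CARD('p)" by (rule prime_card)
  have "padic_abs (of_nat CARD('p) :: 'p padic) = rat_padic_abs CARD('p) (of_nat CARD('p))"
    using padic_abs_of_rat[of "of_nat CARD('p)", where 'p = 'p] by simp
  also have "(of_nat CARD('p) :: rat) = Rat.Fract (int CARD('p)) 1"
    by (simp add: Fract_of_int_quotient)
  also have "rat_padic_abs CARD('p) \<dots> = inverse (real CARD('p))"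
    using p rat_padic_val_Fract[OF p, of "int CARD('p)" 1] prime_gt_0_nat[OF p]
    by (simp add: rat_padic_abs_def Fract_of_int_quotient prime_imp_prime_elem power_int_minus)
  finally show ?thesis .
qed

text \<open>
  The vertices of the rooted tree \<open>\<Gamma>\<^sup>2\<^sub>+\<close>: \<open>Succ1 x\<close> and \<open>Succ2 x\<close> are the direct successors
  \<open>(x,1)\<close> and \<open>(x,2)\<close> of \<open>x\<close>.
\<close>

datatype vertex = Root | Succ1 vertex | Succ2 vertex

definition potts_map :: "'p::prime_card padic \<Rightarrow> nat \<Rightarrow> 'p padic \<Rightarrow> 'p padic" where
  "potts_map \<theta> q t = (\<theta> * t + of_nat q) / (t + \<theta> + of_nat q - 1)"

text \<open>
  Division by zero yields \<open>0\<close> in HOL, so the definedness of the two values of \<open>potts_map\<close> is stated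
  explicitly. The value \<open>h Root\<close> plays no role.
\<close>

definition potts_solution :: "'p::prime_card padic \<Rightarrow> nat \<Rightarrow> (vertex \<Rightarrow> 'p padic) \<Rightarrow> bool" where
  "potts_solution \<theta> q h \<longleftrightarrow> (\<forall>x. x \<noteq> Root \<longrightarrow>
     h (Succ1 x) \<noteq> 1 - \<theta> - of_nat q \<and> h (Succ2 x) \<noteq> 1 - \<theta> - of_nat q \<and>
     h x = potts_map \<theta> q (h (Succ1 x)) * potts_map \<theta> q (h (Succ2 x)))"

end

(* Since |g t - g s| is explicit, the recursion contracts the distance to a fixed point of t = (g t)^2
   uniformly in two regions. In the open unit ball g is an isometry and |g| is bounded by c < 1, because the
   absolute value is discrete. For |t| > 1, |g t| \<ge> min |t| |\<theta>|, so squaring pushes every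
   value up to |\<theta>|^2; there g contracts by |\<theta>|^-2 while |g| = |\<theta>|. As every vertex has
   descendants at all depths, iterating the contraction forces h to equal the fixed point. *)
theory Submission
  imports Defs
begin

section \<open>The absolute value on the p-adic field\<close>

lemma padic_abs_0 [simp]: "padic_abs (0 :: 'p::prime_card padic) = 0"
  by simp

lemma padic_abs_1 [simp]: "padic_abs (1 :: 'p::prime_card padic) = 1"
  using padic_abs_mult[of "1 :: 'p padic" 1] padic_abs_eq_0[of "1 :: 'p padic"] by simp

lemma padic_abs_minus [simp]:
  fixes x :: "'p::prime_card padic"
  shows "padic_abs (- x) = padic_abs x"
proof -
  have "(padic_abs (- 1 :: 'p padic))\<^sup>2 = 1"
    using padic_abs_mult[of "- 1 :: 'p padic" "- 1"] by (simp add: power2_eq_square)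
  hence "padic_abs (- 1 :: 'p padic) = 1"
    using padic_abs_nonneg[of "- 1 :: 'p padic"] by (auto simp: power2_eq_1_iff)
  thus ?thesis using padic_abs_mult[of "- 1" x] by simp
qed

lemma padic_abs_inverse:
  fixes x :: "'p::prime_card padic"
  shows "padic_abs (inverse x) = inverse (padic_abs x)"
proof (cases "x = 0")
  case False
  hence "padic_abs x * padic_abs (inverse x) = 1"
    using padic_abs_mult[of x "inverse x"] by simp
  thus ?thesis by (metis inverse_unique)
qed simp

lemma padic_abs_divide:
  fixes x y :: "'p::prime_card padic"
  shows "padic_abs (x / y) = padic_abs x / padic_abs y"
  by (simp add: divide_inverse padic_abs_mult padic_abs_inverse)

lemma padic_abs_power:
  fixes x :: "'p::prime_card padic"
  shows "padic_abs (x ^ n) = padic_abs x ^ n"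
  by (induction n) (simp_all add: padic_abs_mult)

lemma padic_abs_power_int:
  fixes x :: "'p::prime_card padic"
  shows "padic_abs (x powi k) = padic_abs x powi k"
  by (simp add: power_int_def padic_abs_power padic_abs_inverse)

lemma padic_abs_of_nat_le_1: "padic_abs (of_nat n :: 'p::prime_card padic) \<le> 1"
proof (induction n)
  case (Suc n)
  thus ?case using padic_abs_add[of 1 "of_nat n :: 'p padic"] by simp
qed simp

lemma padic_abs_diff:
  fixes x y :: "'p::prime_card padic"
  shows "padic_abs (x - y) \<le> max (padic_abs x) (padic_abs y)"
  using padic_abs_add[of x "- y"] by simp

text \<open>Since \<open>x\<close> equals \<open>(x + y) - y\<close> and \<open>y\<close> is too
  small to account for the size of \<open>x\<close>, the sum cannot be smaller than
  \<open>x\<close>. All exact sizes of numerators and denominators below come from this domination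
  principle.\<close>

lemma padic_abs_add_eq:
  fixes x y :: "'p::prime_card padic"
  assumes "padic_abs y < padic_abs x"
  shows "padic_abs (x + y) = padic_abs x"
  using padic_abs_add[of x y] padic_abs_diff[of "x + y" y] assms by simp

section \<open>Discreteness of the value group\<close>

lemma rat_padic_abs_discrete:
  assumes p: "prime p" and "rat_padic_abs p r < 1"
  shows "rat_padic_abs p r \<le> inverse (real p)"
proof (cases "r = 0")
  case False
  define k where "k = - rat_padic_val p r"
  have p1: "real p > 1" using prime_gt_1_nat[OF p] by simp
  have eq: "rat_padic_abs p r = real p powi k" using False by (simp add: rat_padic_abs_def k_def)
  have "k < 0"
  proof (rule ccontr)
    assume "\<not> k < 0"
    hence "1 \<le> real p powi k" using p1 by (intro one_le_power_int) auto
    thus False using assms(2) eq by simp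
  qed
  hence "real p powi k \<le> real p powi (-1)" using p1 by (intro power_int_increasing) auto
  thus ?thesis by (simp add: eq)
qed simp

text \<open>Completion creates no values between 1/p and 1: a limit below 1 makes the approximating
  rationals eventually smaller than 1, hence eventually at most 1/p, and this closed bound survives
  in the limit. The gap turns pointwise strict bounds into bounds uniform over all vertices.\<close>

lemma padic_abs_discrete:
  fixes x :: "'p::prime_card padic"
  assumes "padic_abs x < 1"
  shows "padic_abs x \<le> inverse (real CARD('p))"
  using assms
proof (transfer, transfer)
  fix X assume X: "padic_cauchy CARD('p) X" and less: "lim (\<lambda>n. rat_padic_abs CARD('p) (X n)) < 1"
  have L: "(\<lambda>n. rat_padic_abs CARD('p) (X n)) \<longlonglongrightarrow> lim (\<lambda>n. rat_padic_abs CARD('p) (X n))"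
    by (rule padic_cauchy_abs_lim[OF prime_card X])
  have "eventually (\<lambda>n. rat_padic_abs CARD('p) (X n) < 1) sequentially"
    by (rule order_tendstoD(2)[OF L less])
  hence "eventually (\<lambda>n. rat_padic_abs CARD('p) (X n) \<le> inverse (real CARD('p))) sequentially"
    by (rule eventually_mono) (rule rat_padic_abs_discrete[OF prime_card])
  thus "lim (\<lambda>n. rat_padic_abs CARD('p) (X n)) \<le> inverse (real CARD('p))"
    by (rule tendsto_upperbound[OF L]) simp
qed

lemma padic_abs_discrete_gt:
  fixes x :: "'p::prime_card padic"
  assumes "padic_abs x > 1"
  shows "padic_abs x \<ge> real CARD('p)"
proof -
  have p0: "real CARD('p) > 0" using prime_gt_0_nat[OF prime_card[where 'a = 'p]] by simp
  have "padic_abs (inverse x) < 1" using assms by (simp add: padic_abs_inverse inverse_less_1_iff)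
  from padic_abs_discrete[OF this] show ?thesis
    using assms p0 by (simp add: padic_abs_inverse)
qed

section \<open>The Potts map\<close>

text \<open>The map is a Moebius transformation, and
  \<open>(\<theta> - 1) * (\<theta> + of_nat q)\<close> is its determinant
  \<open>\<theta> * (\<theta> + of_nat q - 1) - of_nat q\<close>. Its distortion of distances is
  therefore governed by the two denominators alone.\<close>

lemma potts_map_diff:
  fixes t s \<theta> :: "'p::prime_card padic"
  assumes "t + \<theta> + of_nat q - 1 \<noteq> 0" "s + \<theta> + of_nat q - 1 \<noteq> 0"
  shows "potts_map \<theta> q t - potts_map \<theta> q s =
    (t - s) * ((\<theta> - 1) * (\<theta> + of_nat q)) / ((t + \<theta> + of_nat q - 1) * (s + \<theta> + of_nat q - 1))"
proof -
  have "(\<theta> * t + of_nat q) * (s + \<theta> + of_nat q - 1) - (\<theta> * s + of_nat q) * (t + \<theta> + of_nat q - 1) =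
    (t - s) * ((\<theta> - 1) * (\<theta> + of_nat q))"
    by (simp add: algebra_simps)
  thus ?thesis using assms by (simp add: potts_map_def diff_frac_eq)
qed

text \<open>The cubic \<open>x (x + \<theta> + q - 1)\<^sup>2 = (\<theta> x + q)\<^sup>2\<close> is \<open>x - 1\<close> times the quadratic of the hypothesis.\<close>

lemma potts_map_fixed_point:
  fixes x \<theta> :: "'p::prime_card padic"
  assumes root: "x\<^sup>2 + (2 * \<theta> - \<theta>\<^sup>2 + 2 * of_nat q - 1) * x + (of_nat q)\<^sup>2 = 0"
    and nz: "x + \<theta> + of_nat q - 1 \<noteq> 0"
  shows "potts_map \<theta> q x * potts_map \<theta> q x = x"
proof -
  have "x * (x + \<theta> + of_nat q - 1)\<^sup>2 - (\<theta> * x + of_nat q)\<^sup>2 =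
    (x - 1) * (x\<^sup>2 + (2 * \<theta> - \<theta>\<^sup>2 + 2 * of_nat q - 1) * x + (of_nat q)\<^sup>2)"
    by (simp add: algebra_simps power2_eq_square)
  hence "(\<theta> * x + of_nat q)\<^sup>2 = x * (x + \<theta> + of_nat q - 1)\<^sup>2" using root by simp
  thus ?thesis using nz by (simp add: potts_map_def power2_eq_square)
qed

lemma potts_solutionD:
  assumes "potts_solution \<theta> q h" "x \<noteq> Root"
  shows "h (Succ1 x) + \<theta> + of_nat q - 1 \<noteq> 0" "h (Succ2 x) + \<theta> + of_nat q - 1 \<noteq> 0"
    "h x = potts_map \<theta> q (h (Succ1 x)) * potts_map \<theta> q (h (Succ2 x))"
proof -
  have *: "t + \<theta> + of_nat q - 1 \<noteq> 0" if "t \<noteq> 1 - \<theta> - of_nat q" for t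
    using that by (auto simp: algebra_simps)
  show "h (Succ1 x) + \<theta> + of_nat q - 1 \<noteq> 0" "h (Succ2 x) + \<theta> + of_nat q - 1 \<noteq> 0"
    "h x = potts_map \<theta> q (h (Succ1 x)) * potts_map \<theta> q (h (Succ2 x))"
    using assms * unfolding potts_solution_def by blast+
qed

text \<open>One level of the tree multiplies the bound on the distance to \<open>y\<close> by
  \<open>G * K\<close>. The ultrametric inequality takes a maximum over the two successors, so
  branching costs no factor 2. The bound \<open>B\<close> holds at every non-root vertex, so
  descending \<open>n\<close> levels gives \<open>(G * K) ^ n * B\<close>, which tends to 0.\<close>

lemma potts_solution_eq_fixed_point:
  fixes y \<theta> :: "'p::prime_card padic"
  assumes sol: "potts_solution \<theta> q h"
    and y: "potts_map \<theta> q y * potts_map \<theta> q y = y" "padic_abs (potts_map \<theta> q y) \<le> G"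
    and B: "\<And>x. x \<noteq> Root \<Longrightarrow> padic_abs (h x - y) \<le> B"
    and G: "\<And>x. x \<noteq> Root \<Longrightarrow> padic_abs (potts_map \<theta> q (h x)) \<le> G"
    and K: "\<And>x. x \<noteq> Root \<Longrightarrow>
      padic_abs (potts_map \<theta> q (h x) - potts_map \<theta> q y) \<le> K * padic_abs (h x - y)"
    and K0: "0 \<le> K" and GK: "G * K < 1"
    and x: "x \<noteq> Root"
  shows "h x = y"
proof -
  let ?g = "potts_map \<theta> q"
  have G0: "0 \<le> G" using y(2) padic_abs_nonneg[of "?g y"] by linarith
  have bound: "padic_abs (h x - y) \<le> (G * K) ^ n * B" if "x \<noteq> Root" for x n
    using that
  proof (induction n arbitrary: x)
    case 0
    thus ?case using B by simp
  next
    case (Suc n)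
    let ?a = "h (Succ1 x)" and ?b = "h (Succ2 x)" and ?E = "(G * K) ^ n * B"
    have E: "padic_abs (?g (h v) - ?g y) \<le> K * ?E" if "v \<noteq> Root" for v
      using K[OF that] mult_left_mono[OF Suc.IH[OF that] K0] by linarith
    \<comment> \<open>The nonnegativity required by \<open>mult_mono\<close> holds because this
      number bounds an absolute value.\<close>
    have E0: "0 \<le> K * ?E" using order_trans[OF padic_abs_nonneg E[of "Succ1 x"]] by simp
    \<comment> \<open>The two factors are replaced by \<open>?g y\<close> one at a time, so each
      summand has one small difference and one factor bounded by \<open>G\<close>.\<close>
    have "h x - y = (?g ?a - ?g y) * ?g ?b + ?g y * (?g ?b - ?g y)"
      using potts_solutionD(3)[OF sol Suc.prems] y(1) by (simp add: algebra_simps)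
    hence "padic_abs (h x - y) \<le> max (padic_abs (?g ?a - ?g y) * padic_abs (?g ?b))
        (padic_abs (?g y) * padic_abs (?g ?b - ?g y))"
      using padic_abs_add by (metis padic_abs_mult)
    also have "\<dots> \<le> max ((K * ?E) * G) (G * (K * ?E))"
      using E[of "Succ1 x"] E[of "Succ2 x"] G[of "Succ2 x"] y(2) G0 E0
      by (intro max.mono mult_mono) auto
    also have "\<dots> = (G * K) ^ Suc n * B" by simp
    finally show ?case .
  qed
  have "(\<lambda>n. (G * K) ^ n * B) \<longlonglongrightarrow> 0"
    using G0 K0 GK by (intro tendsto_mult_left_zero LIMSEQ_realpow_zero) auto
  hence "padic_abs (h x - y) \<le> 0"
    by (rule LIMSEQ_le_const) (use bound[OF x] in auto)
  hence "padic_abs (h x - y) = 0" using padic_abs_nonneg[of "h x - y"] by linarith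
  thus ?thesis by simp
qed

section \<open>Size estimates for the Potts map when |theta| > 1\<close>

context
  fixes \<theta> :: "'p::prime_card padic" and q :: nat
  assumes \<theta>: "padic_abs \<theta> > 1"
begin

lemma theta_nonzero: "\<theta> \<noteq> 0"
  using \<theta> by auto

lemma padic_abs_pred_le_1: "padic_abs (of_nat q - 1 :: 'p padic) \<le> 1"
  using padic_abs_diff[of "of_nat q :: 'p padic" 1] padic_abs_of_nat_le_1[of q, where 'p = 'p] by simp

lemma padic_abs_diff_factor: "padic_abs ((\<theta> - 1) * (\<theta> + of_nat q)) = (padic_abs \<theta>)\<^sup>2"
proof -
  have "padic_abs (\<theta> - 1) = padic_abs \<theta>" using padic_abs_add_eq[of "- 1" \<theta>] \<theta> by simp
  moreover have "padic_abs (\<theta> + of_nat q) = padic_abs \<theta>"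
    using padic_abs_add_eq[of "of_nat q" \<theta>] padic_abs_of_nat_le_1[of q, where 'p = 'p] \<theta> by simp
  ultimately show ?thesis by (simp add: padic_abs_mult power2_eq_square)
qed

lemma padic_abs_denom_small:
  assumes "padic_abs t < padic_abs \<theta>"
  shows "padic_abs (t + \<theta> + of_nat q - 1) = padic_abs \<theta>"
proof -
  have "padic_abs (t + (of_nat q - 1)) < padic_abs \<theta>"
    using padic_abs_add[of t "of_nat q - 1"] padic_abs_pred_le_1 assms \<theta> by linarith
  from padic_abs_add_eq[OF this] show ?thesis by (simp add: algebra_simps)
qed

lemma padic_abs_denom_large:
  assumes "padic_abs t > padic_abs \<theta>"
  shows "padic_abs (t + \<theta> + of_nat q - 1) = padic_abs t"
proof -
  have "padic_abs (\<theta> + (of_nat q - 1)) < padic_abs t"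
    using padic_abs_add[of \<theta> "of_nat q - 1"] padic_abs_pred_le_1 assms \<theta> by linarith
  from padic_abs_add_eq[OF this] show ?thesis by (simp add: algebra_simps)
qed

text \<open>When |t| = |theta| the terms \<open>t\<close> and \<open>\<theta>\<close> may cancel, so
  only an upper bound is available. That is the direction needed to bound the map from
  below.\<close>

lemma padic_abs_denom_le:
  assumes "padic_abs t \<le> padic_abs \<theta>"
  shows "padic_abs (t + \<theta> + of_nat q - 1) \<le> padic_abs \<theta>"
proof -
  have "padic_abs (t + \<theta> + of_nat q - 1) \<le> max (padic_abs (t + \<theta>)) (padic_abs (of_nat q - 1 :: 'p padic))"
    using padic_abs_add[of "t + \<theta>" "of_nat q - 1"] by (simp add: algebra_simps)
  thus ?thesis using padic_abs_add[of t \<theta>] padic_abs_pred_le_1 assms \<theta> by linarith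
qed

lemma padic_abs_numer:
  assumes "padic_abs t > 1"
  shows "padic_abs (\<theta> * t + of_nat q) = padic_abs \<theta> * padic_abs t"
proof -
  have "1 < padic_abs (\<theta> * t)" using assms \<theta> by (simp add: padic_abs_mult less_1_mult)
  thus ?thesis
    using padic_abs_add_eq[of "of_nat q" "\<theta> * t"] padic_abs_of_nat_le_1[of q, where 'p = 'p]
    by (simp add: padic_abs_mult)
qed

text \<open>The denominator has size |theta|, while the numerator is at most the larger of |theta|
  |t| and 1. Discreteness replaces |t| < 1 by |t| at most 1/p, which makes the bound independent of
  \<open>t\<close>.\<close>

lemma potts_map_small:
  assumes "padic_abs t < 1"
  shows "padic_abs (potts_map \<theta> q t) \<le> max (inverse (real CARD('p))) (inverse (padic_abs \<theta>))"
proof -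
  have "padic_abs (\<theta> * t + of_nat q) \<le> max (padic_abs \<theta> * padic_abs t) 1"
    using padic_abs_add[of "\<theta> * t" "of_nat q"] padic_abs_of_nat_le_1[of q, where 'p = 'p]
    by (simp add: padic_abs_mult)
  also have "\<dots> \<le> max (padic_abs \<theta> * inverse (real CARD('p))) 1"
    using padic_abs_discrete[OF assms] \<theta> by (intro max.mono mult_left_mono) auto
  finally have "padic_abs (\<theta> * t + of_nat q) \<le> max (padic_abs \<theta> * inverse (real CARD('p))) 1" .
  moreover have "padic_abs (t + \<theta> + of_nat q - 1) = padic_abs \<theta>"
    using assms \<theta> by (simp add: padic_abs_denom_small)
  ultimately show ?thesis
    using \<theta> theta_nonzero by (simp add: potts_map_def padic_abs_divide field_simps max_def split: if_splits)
qed

text \<open>Both denominators have size |theta|, and together they cancel the determinant of size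
  |theta|^2 exactly.\<close>

lemma potts_map_isometry:
  assumes "padic_abs t < 1" "padic_abs s < 1"
  shows "padic_abs (potts_map \<theta> q t - potts_map \<theta> q s) = padic_abs (t - s)"
proof -
  have d: "padic_abs (t + \<theta> + of_nat q - 1) = padic_abs \<theta>" "padic_abs (s + \<theta> + of_nat q - 1) = padic_abs \<theta>"
    using assms \<theta> by (simp_all add: padic_abs_denom_small)
  hence nz: "t + \<theta> + of_nat q - 1 \<noteq> 0" "s + \<theta> + of_nat q - 1 \<noteq> 0" using \<theta> by auto
  have "padic_abs (potts_map \<theta> q t - potts_map \<theta> q s) =
      padic_abs (t - s) * (padic_abs \<theta>)\<^sup>2 / (padic_abs \<theta> * padic_abs \<theta>)"
    by (simp only: potts_map_diff[OF nz] padic_abs_divide padic_abs_mult[of "t - s"] padic_abs_diff_factor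
        padic_abs_mult[of "t + \<theta> + of_nat q - 1"] d)
  thus ?thesis using theta_nonzero by (simp add: power2_eq_square)
qed

text \<open>The numerator has size |theta| |t|. The denominator is at most |theta| if |t| is at most
  |theta|, and has size |t| otherwise.\<close>

lemma potts_map_ge:
  assumes t: "padic_abs t > 1" and nz: "t + \<theta> + of_nat q - 1 \<noteq> 0"
  shows "padic_abs (potts_map \<theta> q t) \<ge> min (padic_abs t) (padic_abs \<theta>)"
proof (cases "padic_abs t \<le> padic_abs \<theta>")
  case True
  have pos: "0 < padic_abs (t + \<theta> + of_nat q - 1)"
    using nz padic_abs_nonneg[of "t + \<theta> + of_nat q - 1"] padic_abs_eq_0[of "t + \<theta> + of_nat q - 1"] by linarith
  have "padic_abs t * padic_abs (t + \<theta> + of_nat q - 1) \<le> padic_abs t * padic_abs \<theta>"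
    using padic_abs_denom_le[OF True] by (intro mult_left_mono) auto
  hence "padic_abs t \<le> padic_abs (potts_map \<theta> q t)"
    using pos by (simp add: potts_map_def padic_abs_divide padic_abs_numer[OF t] pos_le_divide_eq mult.commute)
  thus ?thesis by simp
next
  case False
  moreover have "padic_abs t \<noteq> 0" using t by linarith
  ultimately show ?thesis
    using t by (simp del: padic_abs_eq_0 add: potts_map_def padic_abs_divide padic_abs_numer padic_abs_denom_large)
qed

lemma padic_abs_potts_map_large:
  assumes "padic_abs t > padic_abs \<theta>"
  shows "padic_abs (potts_map \<theta> q t) = padic_abs \<theta>"
proof -
  have "padic_abs t \<noteq> 0" using assms \<theta> by linarith
  thus ?thesis using assms \<theta>
    by (simp del: padic_abs_eq_0 add: potts_map_def padic_abs_divide padic_abs_numer padic_abs_denom_large)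
qed

text \<open>Each denominator now has size |theta|^2, so the determinant of size |theta|^2 is divided
  by |theta|^4.\<close>

lemma potts_map_contraction_large:
  assumes "padic_abs t = (padic_abs \<theta>)\<^sup>2" "padic_abs s = (padic_abs \<theta>)\<^sup>2"
  shows "padic_abs (potts_map \<theta> q t - potts_map \<theta> q s) = inverse ((padic_abs \<theta>)\<^sup>2) * padic_abs (t - s)"
proof -
  have sq: "padic_abs \<theta> < (padic_abs \<theta>)\<^sup>2" using \<theta> by (simp add: power2_eq_square)
  hence d: "padic_abs (t + \<theta> + of_nat q - 1) = (padic_abs \<theta>)\<^sup>2"
      "padic_abs (s + \<theta> + of_nat q - 1) = (padic_abs \<theta>)\<^sup>2"
    using assms by (simp_all add: padic_abs_denom_large)
  hence nz: "t + \<theta> + of_nat q - 1 \<noteq> 0" "s + \<theta> + of_nat q - 1 \<noteq> 0" using \<theta> by auto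
  have "padic_abs (potts_map \<theta> q t - potts_map \<theta> q s) =
      padic_abs (t - s) * (padic_abs \<theta>)\<^sup>2 / ((padic_abs \<theta>)\<^sup>2 * (padic_abs \<theta>)\<^sup>2)"
    by (simp only: potts_map_diff[OF nz] padic_abs_divide padic_abs_mult[of "t - s"] padic_abs_diff_factor
        padic_abs_mult[of "t + \<theta> + of_nat q - 1"] d)
  also have "\<dots> = inverse ((padic_abs \<theta>)\<^sup>2) * padic_abs (t - s)"
  proof -
    have "a * c / (c * c) = inverse c * a" if "c \<noteq> 0" for a c :: real
      using that by (simp add: divide_inverse)
    moreover have "(padic_abs \<theta>)\<^sup>2 \<noteq> 0" using theta_nonzero by simp
    ultimately show ?thesis by blast
  qed
  finally show ?thesis .
qed

text \<open>A uniform lower bound \<open>c\<close> up to |theta| passes to both factors of the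
  recursion and so improves to \<open>c * c\<close>. Once all values exceed |theta|, each factor has
  size exactly |theta|, which fixes the size of the product.\<close>

lemma potts_solution_large:
  assumes sol: "potts_solution \<theta> q h" and large: "\<And>x. x \<noteq> Root \<Longrightarrow> padic_abs (h x) > 1"
    and x: "x \<noteq> Root"
  shows "padic_abs (h x) = (padic_abs \<theta>)\<^sup>2"
proof -
  let ?T = "padic_abs \<theta>" and ?P = "real CARD('p)"
  have P: "?P > 1" using prime_gt_1_nat[OF prime_card[where 'a = 'p]] by simp
  have step: "padic_abs (h x) \<ge> c * c" if c: "0 \<le> c" "c \<le> ?T" "\<And>x. x \<noteq> Root \<Longrightarrow> c \<le> padic_abs (h x)"
    and x: "x \<noteq> Root" for c x
  proof -
    have "c \<le> padic_abs (potts_map \<theta> q (h (Succ1 x)))" "c \<le> padic_abs (potts_map \<theta> q (h (Succ2 x)))"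
      using potts_map_ge[of "h (Succ1 x)"] potts_map_ge[of "h (Succ2 x)"] large[of "Succ1 x"]
        large[of "Succ2 x"] potts_solutionD[OF sol x] c(2) c(3)[of "Succ1 x"] c(3)[of "Succ2 x"] by auto
    thus ?thesis using c(1) by (simp add: potts_solutionD(3)[OF sol x] padic_abs_mult mult_mono)
  qed
  \<comment> \<open>Discreteness starts the induction at p. Squaring gains at least one further
    factor p per level until the cap |theta| is reached.\<close>
  have growth: "min ?T (?P ^ Suc n) \<le> padic_abs (h x)" if "x \<noteq> Root" for x n
    using that
  proof (induction n arbitrary: x)
    case 0
    thus ?case using padic_abs_discrete_gt[OF large] by (simp add: min.coboundedI2)
  next
    case (Suc n)
    let ?c = "min ?T (?P ^ Suc n)"
    have "?P ^ Suc n \<ge> ?P" using P self_le_power[of ?P "Suc n"] by simp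
    hence "?c * ?c \<ge> min ?T (?P ^ Suc (Suc n))"
    proof (cases "?T \<le> ?P ^ Suc n")
      case True
      hence c: "?c = ?T" by simp
      have "?T \<le> ?T * ?T" using \<theta> by simp
      thus ?thesis unfolding c by linarith
    next
      case False
      hence c: "?c = ?P ^ Suc n" by simp
      have "?P * ?P ^ Suc n \<le> ?P ^ Suc n * ?P ^ Suc n"
        using P \<open>?P ^ Suc n \<ge> ?P\<close> by (intro mult_right_mono) auto
      thus ?thesis unfolding c by (simp add: min.coboundedI2)
    qed
    moreover have "?c * ?c \<le> padic_abs (h x)"
      using Suc by (intro step) auto
    ultimately show ?case by linarith
  qed
  obtain n where n: "?T < ?P ^ n" using real_arch_pow[OF P] by blast
  have "?P ^ n \<le> ?P ^ Suc n" using P by simp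
  hence "min ?T (?P ^ Suc n) = ?T" using n by linarith
  hence T: "?T \<le> padic_abs (h x)" if "x \<noteq> Root" for x using growth[OF that, of n] by simp
  \<comment> \<open>One more application with \<open>c\<close> equal to the cap carries all values
    strictly beyond |theta|.\<close>
  have TT: "?T * ?T \<le> padic_abs (h x)" if "x \<noteq> Root" for x using step[OF _ _ T that] \<theta> by simp
  have "?T < ?T * ?T" using \<theta> by simp
  hence "?T < padic_abs (h x)" if "x \<noteq> Root" for x using TT[OF that] by linarith
  thus ?thesis
    by (simp add: potts_solutionD(3)[OF sol x] padic_abs_mult padic_abs_potts_map_large power2_eq_square)
qed

end

section \<open>Identification of the solutions in the two regions\<close>

theorem theorem5p10:
  fixes p q :: nat and N :: int
    and \<theta> x1 x2 :: "'p::prime_card padic"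
    and h :: "vertex \<Rightarrow> 'p padic"
  assumes "p = CARD('p)" and "p \<ge> 3" and "q \<ge> 1"
    and "N < 0" and "\<theta> = of_nat p powi N"
    and "{x. x\<^sup>2 + (2 * \<theta> - \<theta>\<^sup>2 + 2 * of_nat q - 1) * x + (of_nat q)\<^sup>2 = 0} = {x1, x2}"
    and "padic_abs x1 = (padic_abs \<theta>)\<^sup>2"
    and "padic_abs x2 = (padic_abs (of_nat q / \<theta>))\<^sup>2"
    and "potts_solution \<theta> q h"
  shows "((\<forall>x. x \<noteq> Root \<longrightarrow> padic_abs (h x) < 1) \<longrightarrow> (\<forall>x. x \<noteq> Root \<longrightarrow> h x = x2)) \<and>
         ((\<forall>x. x \<noteq> Root \<longrightarrow> padic_abs (h x) > 1) \<longrightarrow> (\<forall>x. x \<noteq> Root \<longrightarrow> h x = x1))"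
proof -
  let ?T = "padic_abs \<theta>" and ?g = "potts_map \<theta> q"
  have P: "real CARD('p) > 1" using prime_gt_1_nat[OF prime_card[where 'a = 'p]] by simp
  \<comment> \<open>As |p| = 1/p, the negative exponent \<open>N\<close> makes |theta| a positive
    power of p.\<close>
  have "?T = real p ^ nat (- N)"
    using assms(1,4,5) by (simp only: padic_abs_power_int padic_abs_prime) (simp add: power_int_def)
  hence \<theta>: "?T > 1" using P assms(1,4) by (simp add: one_less_power)
  have roots: "x\<^sup>2 + (2 * \<theta> - \<theta>\<^sup>2 + 2 * of_nat q - 1) * x + (of_nat q)\<^sup>2 = 0" if "x \<in> {x1, x2}" for x
    using that unfolding assms(6)[symmetric] by simp
  show ?thesis
  proof (intro conjI impI allI)
    fix x assume small: "\<forall>x. x \<noteq> Root \<longrightarrow> padic_abs (h x) < 1" and x: "x \<noteq> Root"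
    let ?G = "max (inverse (real CARD('p))) (inverse ?T)"
    have "padic_abs (of_nat q / \<theta>) < 1"
      using \<theta> padic_abs_of_nat_le_1[of q, where 'p = 'p] by (simp add: padic_abs_divide)
    hence x2: "padic_abs x2 < 1" using assms(8) by (simp add: power_less_one_iff)
    have "padic_abs (x2 + \<theta> + of_nat q - 1) = ?T" using x2 \<theta> by (simp add: padic_abs_denom_small)
    hence "x2 + \<theta> + of_nat q - 1 \<noteq> 0" using \<theta> by auto
    hence fix2: "?g x2 * ?g x2 = x2" using roots[of x2] by (intro potts_map_fixed_point) auto
    show "h x = x2"
    \<comment> \<open>In the unit ball differences are preserved, so \<open>K = 1\<close> and all
      contraction comes from the size \<open>?G < 1\<close> of the other factor.\<close>
    proof (rule potts_solution_eq_fixed_point[OF assms(9) fix2, where G = ?G and B = 1 and K = 1])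
      show "padic_abs (?g x2) \<le> ?G" by (rule potts_map_small[OF \<theta> x2])
      show "padic_abs (?g (h y)) \<le> ?G" if "y \<noteq> Root" for y
        using small that by (intro potts_map_small[OF \<theta>]) auto
      show "padic_abs (h y - x2) \<le> 1" if "y \<noteq> Root" for y
        using padic_abs_diff[of "h y" x2] small that x2 by fastforce
      show "padic_abs (?g (h y) - ?g x2) \<le> 1 * padic_abs (h y - x2)" if "y \<noteq> Root" for y
        using small that x2 potts_map_isometry[OF \<theta>] by simp
      show "?G * 1 < 1" using P \<theta> by (simp add: inverse_less_1_iff)
    qed (use x in auto)
  next
    fix x assume large: "\<forall>x. x \<noteq> Root \<longrightarrow> padic_abs (h x) > 1" and x: "x \<noteq> Root"
    have sq: "?T < ?T\<^sup>2" using \<theta> by (simp add: power2_eq_square)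
    have hT: "padic_abs (h y) = ?T\<^sup>2" if "y \<noteq> Root" for y
      using potts_solution_large[OF \<theta> assms(9)] large that by blast
    have "padic_abs (x1 + \<theta> + of_nat q - 1) = ?T\<^sup>2"
      using assms(7) sq \<theta> by (simp add: padic_abs_denom_large)
    hence "x1 + \<theta> + of_nat q - 1 \<noteq> 0" using \<theta> by auto
    hence fix1: "?g x1 * ?g x1 = x1" using roots[of x1] by (intro potts_map_fixed_point) auto
    show "h x = x1"
    \<comment> \<open>Here the factors are large, but the contraction of differences outweighs them:
      \<open>G * K\<close> equals 1/|theta|. Both \<open>h y\<close> and \<open>x1\<close> have size
      |theta|^2, whence \<open>B\<close>.\<close>
    proof (rule potts_solution_eq_fixed_point[OF assms(9) fix1,
          where G = ?T and B = "?T\<^sup>2" and K = "inverse (?T\<^sup>2)"])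
      show "padic_abs (?g x1) \<le> ?T" using padic_abs_potts_map_large[OF \<theta>] assms(7) sq by simp
      show "padic_abs (?g (h y)) \<le> ?T" if "y \<noteq> Root" for y
        using padic_abs_potts_map_large[OF \<theta>] hT[OF that] sq by simp
      show "padic_abs (h y - x1) \<le> ?T\<^sup>2" if "y \<noteq> Root" for y
        using padic_abs_diff[of "h y" x1] hT[OF that] assms(7) by simp
      show "padic_abs (?g (h y) - ?g x1) \<le> inverse (?T\<^sup>2) * padic_abs (h y - x1)" if "y \<noteq> Root" for y
        using potts_map_contraction_large[OF \<theta> hT[OF that] assms(7)] by simp
      show "?T * inverse (?T\<^sup>2) < 1" using \<theta> by (simp add: field_simps power2_eq_square)
    qed (use x in auto)
  qed
qed

end
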